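(* Let $(L,[-,-,-])$ be a ternary Leibniz algebra over a field $\mathbb{K}$ and let $R:L\to L$ be an invertible Rota-Baxter operator of weight $\lambda\in\mathbb{K}$ on $L$. Then $R^{-1}:L\to L$ is a derivation of weight $\lambda$ on $L$.
   Context: A ternary Leibniz algebra is a vector space $L$ with a trilinear bracket satisfying $[[x,y,z],t,u]=[x,y,[z,t,u]]+[x,[y,t,u],z]+[[x,t,u],y,z]$ for all $x,y,z,t,u\in L$. A Rota-Baxter operator of weight $\lambda$ on it is a linear map $R$ with, for all $x,y,z\in L$, \begin{align*} [R(x),R(y),R(z)]=R\big(&[R(x),R(y),z]+[R(x),y,R(z)]+[x,R(y),R(z)]\\ &+\lambda[R(x),y,z]+\lambda[x,R(y),z]+\lambda[x,y,R(z)]+\lambda^2[x,y,z]\big). \end{align*} A derivation of weight $\lambda$ on it is a linear map $D$ with, for all $x,y,z\in L$, \begin{align*} D([x,y,z])&=[D(x),y,z]+[x,D(y),z]+[x,y,D(z)]\\ &\quad+\lambda[D(x),D(y),z]+\lambda[x,D(y),D(z)]+\lambda[D(x),y,D(z)]+\lambda^2[D(x),D(y),D(z)]. \end{align*} *)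

theory Defs
  imports Main "HOL.Vector_Spaces"
begin

locale ternary_leibniz_algebra = vector_space scale
  for scale :: "'k::field \<Rightarrow> 'v::ab_group_add \<Rightarrow> 'v" +
  fixes br :: "'v \<Rightarrow> 'v \<Rightarrow> 'v \<Rightarrow> 'v"
  assumes linear_fst: "\<And>y z. Vector_Spaces.linear scale scale (\<lambda>x. br x y z)"
    and linear_snd: "\<And>x z. Vector_Spaces.linear scale scale (\<lambda>y. br x y z)"
    and linear_trd: "\<And>x y. Vector_Spaces.linear scale scale (\<lambda>z. br x y z)"
    and leibniz: "\<And>x y z t u. br (br x y z) t u
      = br x y (br z t u) + br x (br y t u) z + br (br x t u) y z"

definition rota_baxter_operator ::
  "('k::field \<Rightarrow> 'v::ab_group_add \<Rightarrow> 'v) \<Rightarrow> ('v \<Rightarrow> 'v \<Rightarrow> 'v \<Rightarrow> 'v) \<Rightarrow> 'k \<Rightarrow> ('v \<Rightarrow> 'v) \<Rightarrow> bool"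
  where "rota_baxter_operator scale br lam R \<longleftrightarrow>
    Vector_Spaces.linear scale scale R \<and>
    (\<forall>x y z. br (R x) (R y) (R z) =
      R (br (R x) (R y) z + br (R x) y (R z) + br x (R y) (R z)
        + scale lam (br (R x) y z) + scale lam (br x (R y) z) + scale lam (br x y (R z))
        + scale (lam\<^sup>2) (br x y z)))"

definition weighted_derivation ::
  "('k::field \<Rightarrow> 'v::ab_group_add \<Rightarrow> 'v) \<Rightarrow> ('v \<Rightarrow> 'v \<Rightarrow> 'v \<Rightarrow> 'v) \<Rightarrow> 'k \<Rightarrow> ('v \<Rightarrow> 'v) \<Rightarrow> bool"
  where "weighted_derivation scale br lam D \<longleftrightarrow>
    Vector_Spaces.linear scale scale D \<and>
    (\<forall>x y z. D (br x y z) =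
      br (D x) y z + br x (D y) z + br x y (D z)
        + scale lam (br (D x) (D y) z) + scale lam (br x (D y) (D z))
        + scale lam (br (D x) y (D z))
        + scale (lam\<^sup>2) (br (D x) (D y) (D z)))"

end

theory Submission
  imports Defs
begin

text \<open>Substituting \<open>x = R x'\<close>, \<open>y = R y'\<close>, \<open>z = R z'\<close>, the Rota-Baxter identity and the
  derivation identity are the same equation read in opposite directions: a factor \<open>R x'\<close> in the
  first is a bare \<open>x\<close> in the second, and a bare \<open>x'\<close> is \<open>R\<^sup>-\<^sup>1 x\<close>. Applying
  \<open>R\<^sup>-\<^sup>1\<close> to both sides of the Rota-Baxter identity therefore gives the derivation identity
  of the same weight. What remains is that the inverse of a linear bijection is linear.\<close>

lemma linear_inv:
  assumes lin: "Vector_Spaces.linear scale scale' f" and bij: "bij f"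
  shows "Vector_Spaces.linear scale' scale (inv f)"
proof -
  interpret f: Vector_Spaces.linear scale scale' f by (fact lin)
  have f_inv: "f (inv f x) = x" for x
    using bij by (simp add: bij_is_surj surj_f_inv_f)
  have inv_eqI: "inv f y = x" if "f x = y" for x y
    using bij that by (auto simp: bij_is_inj inv_f_f)
  show ?thesis
    by unfold_locales (auto intro!: inv_eqI simp: f.add f.scale f_inv)
qed

theorem proposition2p12:
  fixes scale :: "'k::field \<Rightarrow> 'v::ab_group_add \<Rightarrow> 'v"
    and br :: "'v \<Rightarrow> 'v \<Rightarrow> 'v \<Rightarrow> 'v"
    and lam :: 'k
    and R :: "'v \<Rightarrow> 'v"
  assumes "ternary_leibniz_algebra scale br"
    and "rota_baxter_operator scale br lam R"
    and "bij R"
  shows "weighted_derivation scale br lam (inv R)"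
proof -
  let ?D = "inv R"
  have R_D: "R (?D x) = x" for x
    using \<open>bij R\<close> by (simp add: bij_is_surj surj_f_inv_f)
  have D_R: "?D (R x) = x" for x
    using \<open>bij R\<close> by (simp add: bij_is_inj inv_f_f)
  have lin: "Vector_Spaces.linear scale scale R"
    and rb: "br (R x) (R y) (R z) =
      R (br (R x) (R y) z + br (R x) y (R z) + br x (R y) (R z)
        + scale lam (br (R x) y z) + scale lam (br x (R y) z) + scale lam (br x y (R z))
        + scale (lam\<^sup>2) (br x y z))" for x y z
    using assms(2) unfolding rota_baxter_operator_def by blast+
  have "?D (br x y z) =
      br (?D x) y z + br x (?D y) z + br x y (?D z)
        + scale lam (br (?D x) (?D y) z) + scale lam (br x (?D y) (?D z))
        + scale lam (br (?D x) y (?D z))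
        + scale (lam\<^sup>2) (br (?D x) (?D y) (?D z))" for x y z
  proof -
    have "?D (br x y z) =
        br x y (?D z) + br x (?D y) z + br (?D x) y z
          + scale lam (br x (?D y) (?D z)) + scale lam (br (?D x) y (?D z))
          + scale lam (br (?D x) (?D y) z)
          + scale (lam\<^sup>2) (br (?D x) (?D y) (?D z))"
      using arg_cong[OF rb[of "?D x" "?D y" "?D z"], of ?D] by (simp only: R_D D_R)
    then show ?thesis
      by (simp add: ac_simps)
  qed
  with linear_inv[OF lin \<open>bij R\<close>] show ?thesis
    unfolding weighted_derivation_def by blast
qed

end
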